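(* Let $X$ be a finite graph. Then $NC^*(X)$ is compact if and only if $X$ is homeomorphic to $[0,1]$ or to the circle $S^1$.
   Context: A continuum is a compact connected metric space with more than one point; a subcontinuum of $X$ is a nonempty closed connected subset of $X$ (one-point sets are allowed). An arc is a space homeomorphic to $[0,1]$. A finite graph is a continuum that can be written as the union of finitely many arcs, any two of which can intersect in at most one or both of their end points. $C(X)$ is the set of all subcontinua of $X$, endowed with the Hausdorff metric (equivalently, the Vietoris topology), and $NC^*(X)=\{A\in C(X): X\setminus A \text{ is connected}\}$ with the subspace topology; the empty set counts as connected, so $X\in NC^*(X)$. *)

theory Defs
  imports "HOL-Analysis.Analysis"
begin

definition continuum :: "'a::metric_space set \<Rightarrow> bool" where
  "continuum X \<longleftrightarrow> compact X \<and> connected X \<and> (\<exists>x\<in>X. \<exists>y\<in>X. x \<noteq> y)"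

definition finite_graph :: "'a::metric_space set \<Rightarrow> bool" where
  "finite_graph X \<longleftrightarrow>
     continuum X \<and>
     (\<exists>G. finite G \<and> (\<forall>g\<in>G. arc g) \<and> X = (\<Union>g\<in>G. path_image g) \<and>
        pairwise (\<lambda>g h. path_image g \<inter> path_image h \<subseteq>
          {pathstart g, pathfinish g} \<inter> {pathstart h, pathfinish h}) G)"

text \<open>The arcs of a finite graph are given by parametrisations. The next lemma says that their
  images are exactly the spaces homeomorphic to the unit interval.\<close>

lemma homeomorphic_unit_interval_iff_arc:
  fixes A :: "'a::metric_space set"
  shows "A homeomorphic {0..1::real} \<longleftrightarrow> (\<exists>g. arc g \<and> path_image g = A)"
proof
  assume "A homeomorphic {0..1::real}"
  then have "{0..1::real} homeomorphic A"
    by (rule iffD1[OF homeomorphic_sym])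
  then obtain g h where "homeomorphism {0..1::real} A g h"
    unfolding homeomorphic_def by blast
  then show "\<exists>g. arc g \<and> path_image g = A"
    unfolding homeomorphism_def arc_def path_def path_image_def
    by (intro exI[of _ g]) (auto intro: inj_on_inverseI)
next
  assume "\<exists>g. arc g \<and> path_image g = A"
  then show "A homeomorphic {0..1::real}"
    using homeomorphic_arc_image_interval[of _ 0 "1::real"] by auto
qed

definition subcontinua :: "'a::metric_space set \<Rightarrow> 'a set set" where
  "subcontinua X = {A. A \<noteq> {} \<and> closedin (top_of_set X) A \<and> connected A}"

text \<open>The value \<open>0\<close> for empty or unbounded arguments is a totalising default; it is never used for
  subcontinua of a compact space, on which this is a genuine metric (shown below).\<close>

definition hausdorff_dist :: "'a::metric_space set \<Rightarrow> 'a set \<Rightarrow> real" where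
  "hausdorff_dist A B =
     (if A = {} \<or> B = {} \<or> \<not> bounded A \<or> \<not> bounded B then 0
      else max (SUP a\<in>A. infdist a B) (SUP b\<in>B. infdist b A))"

lemma bdd_above_infdist:
  assumes "bounded A" "B \<noteq> {}"
  shows "bdd_above ((\<lambda>a. infdist a B) ` A)"
proof -
  obtain b where b: "b \<in> B" using assms(2) by blast
  obtain e where e: "\<forall>a\<in>A. dist b a \<le> e"
    using assms(1) bounded_any_center by metis
  show ?thesis
    by (rule bdd_aboveI2[of _ _ e]) (metis b e dist_commute infdist_le2)
qed

lemma hausdorff_dist_le_iff:
  assumes "A \<noteq> {}" "B \<noteq> {}" "bounded A" "bounded B"
  shows "hausdorff_dist A B \<le> r \<longleftrightarrow> (\<forall>a\<in>A. infdist a B \<le> r) \<and> (\<forall>b\<in>B. infdist b A \<le> r)"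
  using assms by (simp add: hausdorff_dist_def cSUP_le_iff bdd_above_infdist)

lemma hausdorff_dist_nonneg: "0 \<le> hausdorff_dist A B"
proof (cases "A = {} \<or> B = {} \<or> \<not> bounded A \<or> \<not> bounded B")
  case False
  then obtain a where "a \<in> A" by blast
  with False have "infdist a B \<le> hausdorff_dist A B"
    using hausdorff_dist_le_iff[of A B "hausdorff_dist A B"] by auto
  then show ?thesis using infdist_nonneg order_trans by blast
qed (auto simp: hausdorff_dist_def)

lemma hausdorff_dist_commute: "hausdorff_dist A B = hausdorff_dist B A"
  by (auto simp: hausdorff_dist_def max.commute)

lemma infdist_le_hausdorff_dist:
  assumes "A \<noteq> {}" "B \<noteq> {}" "bounded A" "bounded B" "bounded C" "C \<noteq> {}" "a \<in> A"
  shows "infdist a C \<le> hausdorff_dist A B + hausdorff_dist B C"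
proof (rule field_le_epsilon)
  fix e :: real assume "0 < e"
  have ab: "infdist a B \<le> hausdorff_dist A B"
    using assms hausdorff_dist_le_iff[of A B "hausdorff_dist A B"] by auto
  have "(INF b\<in>B. dist a b) < infdist a B + e"
    using \<open>0 < e\<close> assms(2) by (simp add: infdist_notempty)
  then obtain b where b: "b \<in> B" "dist a b < infdist a B + e"
    using cINF_less_iff[of B "dist a" "infdist a B + e"] assms(2) by auto
  have "infdist b C \<le> hausdorff_dist B C"
    using assms b hausdorff_dist_le_iff[of B C "hausdorff_dist B C"] by auto
  moreover have "infdist a C \<le> infdist b C + dist a b" by (rule infdist_triangle)
  ultimately show "infdist a C \<le> hausdorff_dist A B + hausdorff_dist B C + e"
    using ab b by linarith
qed

lemma Metric_space_subcontinua:
  fixes X :: "'a::metric_space set"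
  assumes "compact X"
  shows "Metric_space (subcontinua X) hausdorff_dist"
proof
  have sub: "A \<noteq> {} \<and> closed A \<and> bounded A" if "A \<in> subcontinua X" for A
    using that assms closedin_compact[of X A]
    by (auto simp: subcontinua_def compact_imp_bounded compact_imp_closed)
  fix A B C :: "'a set"
  show "0 \<le> hausdorff_dist A B" by (rule hausdorff_dist_nonneg)
  show "hausdorff_dist A B = hausdorff_dist B A" by (rule hausdorff_dist_commute)
  assume A: "A \<in> subcontinua X" and B: "B \<in> subcontinua X"
  show "hausdorff_dist A B = 0 \<longleftrightarrow> A = B"
  proof
    assume "hausdorff_dist A B = 0"
    then have "\<forall>a\<in>A. infdist a B \<le> 0" "\<forall>b\<in>B. infdist b A \<le> 0"
      using hausdorff_dist_le_iff[of A B 0] sub[OF A] sub[OF B] by auto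
    then show "A = B"
      using in_closed_iff_infdist_zero[of A] in_closed_iff_infdist_zero[of B]
        infdist_nonneg sub[OF A] sub[OF B]
      by (meson order_antisym subsetI)
  next
    assume "A = B"
    then have "hausdorff_dist A B \<le> 0"
      using hausdorff_dist_le_iff[of A B 0] sub[OF A] by simp
    then show "hausdorff_dist A B = 0"
      using hausdorff_dist_nonneg[of A B] by linarith
  qed
  assume C: "C \<in> subcontinua X"
  show "hausdorff_dist A C \<le> hausdorff_dist A B + hausdorff_dist B C"
    using hausdorff_dist_le_iff[of A C] infdist_le_hausdorff_dist[of A B C]
      infdist_le_hausdorff_dist[of C B A] hausdorff_dist_commute[of A B]
      hausdorff_dist_commute[of B C] sub[OF A] sub[OF B] sub[OF C]
    by (smt (verit, best))
qed

definition hyperspace :: "'a::metric_space set \<Rightarrow> 'a set topology" where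
  "hyperspace X = Metric_space.mtopology (subcontinua X) hausdorff_dist"

text \<open>The empty set is connected in the library, so \<open>X\<close> itself belongs to \<open>NC_star X\<close> when \<open>X\<close> is a
  continuum.\<close>

definition NC_star :: "'a::metric_space set \<Rightarrow> 'a set set" where
  "NC_star X = {A \<in> subcontinua X. connected (X - A)}"

end

theory Submission
  imports Defs
begin

text \<open>
  For an arc, \<open>NC_star\<close> consists of the subarcs that contain an end point of the arc; for a circle,
  it consists of all subcontinua. In both cases it is the family of images of intervals whose pairs of
  end points range over a compact set, and such a family is a continuous image of that set
  (\<open>compactin_interval_images\<close>).

  Conversely, a finite graph in which no point is a common end point of three arcs is an arc or a
  circle, because the arcs can be concatenated one after another
  (\<open>arc_or_circle_if_no_branching\<close>). So suppose that at least three arcs end at \<open>v\<close>. Halving them gives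
  an open star around \<open>v\<close> with at least three legs. Take a component \<open>K\<close> of the outside of the open
  star and let it grow along one of the legs that it touches, from the tip of the leg towards \<open>v\<close>.
  Before \<open>v\<close> is reached the complement stays connected, since each other component of the outside is
  tied to \<open>v\<close> by a leg of its own (\<open>connected_complement_grown\<close>); here boundary bumping is used to see
  that each component touches a leg. When \<open>v\<close> is reached, the remaining legs lose their common point
  and, for a suitable \<open>K\<close>, the complement falls apart (\<open>disconnected_complement_grown_0\<close>). A component
  that touches two legs is suitable; if there is none, every component is. Thus \<open>NC_star X\<close> is not
  closed in the hyperspace, hence not compact.
\<close>

section \<open>Subcontinua and the Hausdorff metric\<close>

lemma subcontinua_iff:
  assumes "compact X"
  shows "A \<in> subcontinua X \<longleftrightarrow> A \<noteq> {} \<and> A \<subseteq> X \<and> closed A \<and> connected A"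
  using assms closedin_closed_eq[of X A] compact_imp_closed[of X] by (auto simp: subcontinua_def)

lemma subcontinua_bounded:
  assumes "compact X" "A \<in> subcontinua X"
  shows "A \<noteq> {}" "bounded A"
  using assms by (auto simp: subcontinua_iff intro: bounded_subset compact_imp_bounded)

lemma hausdorff_dist_leI:
  assumes "A \<noteq> {}" "B \<noteq> {}" "bounded A" "bounded B"
    and "\<And>a. a \<in> A \<Longrightarrow> \<exists>b\<in>B. dist a b \<le> r"
    and "\<And>b. b \<in> B \<Longrightarrow> \<exists>a\<in>A. dist b a \<le> r"
  shows "hausdorff_dist A B \<le> r"
  unfolding hausdorff_dist_le_iff[OF assms(1-4)] using assms(5,6) by (meson infdist_le2)

lemma NC_star_iff:
  assumes "compact X"
  shows "A \<in> NC_star X \<longleftrightarrow>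
    A \<noteq> {} \<and> A \<subseteq> X \<and> closed A \<and> connected A \<and> connected (X - A)"
  using subcontinua_iff[OF assms] by (auto simp: NC_star_def)

text \<open>A compact subset of a metric space is closed. This is how compactness gets refuted below: a
  subcontinuum with disconnected complement is approximated by ones with connected complement.\<close>

lemma NC_star_limit:
  assumes X: "compact X" and cpt: "compactin (hyperspace X) (NC_star X)"
    and L: "L \<in> subcontinua X"
    and lim: "\<And>e. e > 0 \<Longrightarrow> \<exists>A \<in> NC_star X. hausdorff_dist L A < e"
  shows "L \<in> NC_star X"
proof (rule ccontr)
  assume "L \<notin> NC_star X"
  interpret Metric_space "subcontinua X" hausdorff_dist
    by (rule Metric_space_subcontinua[OF X])
  have "closedin mtopology (NC_star X)"
    using cpt by (intro compactin_imp_closedin Hausdorff_space_mtopology) (simp add: hyperspace_def)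
  with L \<open>L \<notin> NC_star X\<close> obtain r where "r > 0" "disjnt (NC_star X) (mball L r)"
    unfolding closedin_metric by blast
  moreover obtain A where "A \<in> NC_star X" "hausdorff_dist L A < r"
    using lim[OF \<open>r > 0\<close>] by blast
  ultimately show False
    using L by (auto simp: NC_star_def disjnt_iff)
qed

lemma dist_clamp_le:
  fixes a b :: real
  assumes "t \<in> {a..b}" "a' \<le> b'"
  shows "\<exists>u\<in>{a'..b'}. dist t u \<le> max (dist a a') (dist b b')"
  using assms by (intro bexI[of _ "max a' (min b' t)"]) (auto simp: dist_real_def)

text \<open>A uniformly continuous \<open>f\<close> turns a small change of the end points of \<open>{a..b}\<close> into a small
  change of \<open>f ` {a..b}\<close> in the Hausdorff metric, because clamping sends each point of one interval to
  a nearby point of the other. So the family is a continuous image of the compact parameter set \<open>D\<close>.\<close>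

lemma compactin_interval_images:
  fixes f :: "real \<Rightarrow> 'a::metric_space"
  assumes X: "compact X" and f: "continuous_on {p..q} f" "f ` {p..q} \<subseteq> X"
    and D: "compact D" "\<And>a b. (a, b) \<in> D \<Longrightarrow> p \<le> a \<and> a \<le> b \<and> b \<le> q"
  shows "compactin (hyperspace X) ((\<lambda>(a, b). f ` {a..b}) ` D)"
proof -
  interpret Metric_space "subcontinua X" hausdorff_dist
    by (rule Metric_space_subcontinua[OF X])
  let ?F = "\<lambda>(a, b). f ` {a..b}"
  have sub: "?F z \<in> subcontinua X" if "z \<in> D" for z
  proof -
    obtain a b where z: "z = (a, b)" by (cases z)
    with that D have ab: "p \<le> a" "a \<le> b" "b \<le> q" by auto
    then have cf: "continuous_on {a..b} f"
      by (intro continuous_on_subset[OF f(1)]) auto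
    show ?thesis
      using ab f(2) compact_continuous_image[OF cf] connected_continuous_image[OF cf]
      by (auto simp: subcontinua_iff[OF X] z compact_imp_closed)
  qed
  have uc: "uniformly_continuous_on {p..q} f"
    by (intro compact_uniformly_continuous f(1)) auto
  have "continuous_map (top_of_set D) mtopology ?F"
    unfolding continuous_map_to_metric
  proof (intro ballI allI impI)
    fix z e assume z: "z \<in> topspace (top_of_set D)" and e: "(e::real) > 0"
    obtain a b where ab: "z = (a, b)" by (cases z)
    obtain d where d: "d > 0" "\<And>s t. s \<in> {p..q} \<Longrightarrow> t \<in> {p..q} \<Longrightarrow> dist s t < d \<Longrightarrow> dist (f s) (f t) < e/2"
      using uc e unfolding uniformly_continuous_on_def by (metis dist_commute half_gt_zero)
    have near: "\<exists>u\<in>{a'..b'}. dist (f t) (f u) \<le> e/2"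
      if 1: "(a, b) \<in> D" and 2: "(a', b') \<in> D" and 3: "t \<in> {a..b}"
        and 4: "dist (a, b) (a', b') < d" for a b a' b' t
    proof -
      have "dist a a' < d" "dist b b' < d"
        using 4 dist_fst_le[of "(a, b)" "(a', b')"] dist_snd_le[of "(a, b)" "(a', b')"] by auto
      moreover obtain u where "u \<in> {a'..b'}" "dist t u \<le> max (dist a a') (dist b b')"
        using dist_clamp_le[OF 3, of a' b'] D(2)[OF 2] by auto
      ultimately have "u \<in> {a'..b'}" "dist t u < d" by auto
      moreover have "t \<in> {p..q}" "u \<in> {p..q}"
        using 3 \<open>u \<in> {a'..b'}\<close> D(2)[OF 1] D(2)[OF 2] by auto
      ultimately show ?thesis using d(2) by (meson less_imp_le)
    qed
    have "?F y \<in> mball (?F z) e" if y: "y \<in> D \<inter> ball z d" for y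
    proof -
      obtain a' b' where ab': "y = (a', b')" by (cases y)
      have "hausdorff_dist (?F z) (?F y) \<le> e/2"
        using subcontinua_bounded[OF X sub] z y
          near[of a b a' b'] near[of a' b' a b] unfolding ab ab'
        by (intro hausdorff_dist_leI) (auto simp: dist_commute)
      then show ?thesis using e y z sub by auto
    qed
    then show "\<exists>U. openin (top_of_set D) U \<and> z \<in> U \<and> (\<forall>y\<in>U. ?F y \<in> mball (?F z) e)"
      using z d(1) by (intro exI[of _ "D \<inter> ball z d"]) (auto intro: openin_open_Int)
  qed
  moreover have "compactin (top_of_set D) D"
    using D(1) by (simp add: compactin_subtopology)
  ultimately show ?thesis
    unfolding hyperspace_def by (intro image_compactin)
qed

section \<open>Arcs and circles\<close>

text \<open>On a compact set, a continuous injection has a continuous inverse, so connectedness can be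
  pulled back to the real line.\<close>

lemma connected_image_interval:
  fixes f :: "real \<Rightarrow> 'a::t2_space"
  assumes B: "compact B" and f: "continuous_on B f" "inj_on f B"
    and "connected (f ` B)" "B \<noteq> {}"
  obtains a b where "a \<le> b" "B = {a..b}"
proof -
  have "continuous_on (f ` B) (inv_into B f)"
    by (rule continuous_on_inv[OF f(1) B]) (simp add: f(2))
  then have "connected (inv_into B f ` f ` B)"
    using connected_continuous_image assms(4) by blast
  then have "connected B" using f(2) by simp
  then obtain a b where "B = {a..b}"
    using connected_compact_interval_1 B by meson
  with \<open>B \<noteq> {}\<close> that show ?thesis by fastforce
qed

text \<open>The members of \<open>NC_star\<close> of an arc are exactly the subarcs that contain an end point of the
  arc: removing any other subarc separates the two end points.\<close>

lemma compactin_NC_star_arc: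
  fixes X :: "'a::metric_space set"
  assumes "X homeomorphic {0..1::real}"
  shows "compactin (hyperspace X) (NC_star X)"
proof -
  obtain h f where hf: "homeomorphism X {0..1::real} h f"
    using assms homeomorphic_def by blast
  have f: "continuous_on {0..1} f" "f ` {0..1} = X" "\<And>t. t \<in> {0..1} \<Longrightarrow> h (f t) = t"
    and h: "continuous_on X h" "h ` X = {0..1}" "\<And>x. x \<in> X \<Longrightarrow> f (h x) = x"
    using hf by (auto simp: homeomorphism_def)
  have inj: "inj_on f {0..1}" using f(3) by (metis inj_onI)
  have X: "compact X" using compact_continuous_image[OF f(1)] f(2) by simp
  let ?D = "{0} \<times> {0..1} \<union> {0..1} \<times> {1::real}"
  have "NC_star X = (\<lambda>(a, b). f ` {a..b}) ` ?D"
  proof (intro equalityI subsetI)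
    fix A assume "A \<in> NC_star X"
    then have A: "A \<noteq> {}" "A \<subseteq> X" "closed A" "connected A" "connected (X - A)"
      by (auto simp: NC_star_iff[OF X])
    define B where "B = h ` A"
    have fB: "f ` B = A"
      using A(2) h(3) by (force simp: B_def image_image)
    have B01: "B \<subseteq> {0..1}"
      using A(2) h(2) by (auto simp: B_def)
    have "compact A"
      using A(2,3) X by (metis compact_Int_closed inf.absorb_iff2)
    then have cB: "compact B"
      unfolding B_def using A(2) by (intro compact_continuous_image continuous_on_subset[OF h(1)])
    obtain a b where ab: "a \<le> b" "B = {a..b}"
    proof (rule connected_image_interval[OF cB])
      show "continuous_on B f" "inj_on f B"
        using B01 f(1) inj by (auto intro: continuous_on_subset inj_on_subset)
    qed (use fB A in auto)
    have hc: "connected (h ` (X - A))"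
      by (intro connected_continuous_image continuous_on_subset[OF h(1)] A) auto
    have hX: "t \<in> h ` (X - A)" if "t \<in> {0..1}" "t \<notin> B" for t
      using that f unfolding B_def by (intro image_eqI[of _ _ "f t"]) force+
    have "a = 0 \<or> b = 1"
    proof (rule ccontr)
      assume "\<not> (a = 0 \<or> b = 1)"
      then have "0 \<in> h ` (X - A)" "1 \<in> h ` (X - A)" "a \<in> {0..1}"
        using B01 ab by (auto intro!: hX)
      then have "a \<in> h ` (X - A)"
        using connectedD_interval[OF hc, of 0 1 a] by auto
      then obtain x where "x \<in> X - A" "h x = a" by blast
      moreover have "f a \<in> A" using fB ab by auto
      ultimately show False using h(3) by auto
    qed
    then show "A \<in> (\<lambda>(a, b). f ` {a..b}) ` ?D"
      using ab B01 fB by (intro image_eqI[of _ _ "(a, b)"]) auto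
  next
    fix A assume "A \<in> (\<lambda>(a, b). f ` {a..b}) ` ?D"
    then obtain a b where ab: "(a, b) \<in> ?D" "A = f ` {a..b}" by blast
    then have sub: "{a..b} \<subseteq> {0..1}" "{a..b} \<noteq> {}" by auto
    have cf: "continuous_on {a..b} f" using f(1) sub by (auto intro: continuous_on_subset)
    have "X - A = f ` ({0..1} - {a..b})"
      using ab(2) f(2) inj sub by (simp add: inj_on_image_set_diff[OF inj])
    moreover have "is_interval ({0..1} - {a..b})"
      using ab(1) by (auto simp: is_interval_1)
    ultimately have "connected (X - A)"
      using continuous_on_subset[OF f(1), of "{0..1} - {a..b}"]
      by (auto intro!: connected_continuous_image is_interval_connected)
    then show "A \<in> NC_star X"
      using ab(2) sub f(2) compact_continuous_image[OF cf] connected_continuous_image[OF cf]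
      by (auto simp: NC_star_iff[OF X] compact_imp_closed)
  qed
  also have "compactin (hyperspace X) \<dots>"
    by (rule compactin_interval_images[OF X f(1)]) (use f(2) in \<open>auto intro!: compact_Un compact_Times\<close>)
  finally show ?thesis .
qed

text \<open>One full turn, begun at an arbitrary angle \<open>a\<close>, parametrises the circle bijectively.\<close>

lemma circle_arc_parametrisation:
  fixes h :: "complex \<Rightarrow> 'a" and a :: real
  assumes "inj_on h (sphere 0 1)"
  shows "inj_on (\<lambda>t. h (cis t)) {a..<a + 2 * pi}"
    and "(\<lambda>t. h (cis t)) ` {a..<a + 2 * pi} = h ` sphere 0 1"
proof -
  show "inj_on (\<lambda>t. h (cis t)) {a..<a + 2 * pi}"
  proof (rule inj_onI)
    fix t u assume t: "t \<in> {a..<a + 2 * pi}" and u: "u \<in> {a..<a + 2 * pi}"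
      and "h (cis t) = h (cis u)"
    then have "cis t = cis u" using assms by (auto simp: inj_on_def)
    then obtain n :: int where n: "t = u + 2 * pi * n"
      using sin_cos_eq_iff[of t u] by (auto simp: complex_eq_iff)
    have "2 * pi * of_int n < 2 * pi * 1" "2 * pi * (- 1) < 2 * pi * of_int n"
      using t u unfolding n atLeastLessThan_iff by linarith+
    then have "of_int n < (1::real)" "- 1 < (of_int n :: real)"
      by (simp_all only: mult_less_cancel_left_pos pi_gt_zero zero_less_mult_iff zero_less_numeral simp_thms)
    then have "n = 0" by linarith
    then show "t = u" using n by simp
  qed
  have "\<exists>t\<in>{a..<a + 2 * pi}. cis t = z" if "z \<in> sphere 0 1" for z
  proof -
    define w where "w = (Arg z - a) / (2 * pi)"
    have z: "cis (Arg z) = z"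
      using that by (metis cis_Arg mem_sphere_0 norm_zero sgn_eq div_by_1 of_real_1 zero_neq_one)
    have "a + 2 * pi * frac w = Arg z - 2 * pi * of_int \<lfloor>w\<rfloor>"
      by (simp add: frac_def w_def field_simps)
    then have "cis (a + 2 * pi * frac w) = z"
      by (simp add: z flip: cis_divide)
    moreover have "a + 2 * pi * frac w \<in> {a..<a + 2 * pi}"
      using frac_ge_0[of w] frac_lt_1[of w] by simp
    ultimately show ?thesis by blast
  qed
  then show "(\<lambda>t. h (cis t)) ` {a..<a + 2 * pi} = h ` sphere 0 1"
    by (force simp: image_iff)
qed

text \<open>In a circle every subcontinuum has connected complement, and all of them are images of
  intervals of length at most \<open>2 * pi\<close>. A proper subcontinuum misses some point; cutting the circle
  open there turns it into a subset of an interval.\<close>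

lemma compactin_NC_star_circle:
  fixes X :: "'a::metric_space set"
  assumes "X homeomorphic sphere (0::complex) 1"
  shows "compactin (hyperspace X) (NC_star X)"
proof -
  obtain h where h: "continuous_on (sphere (0::complex) 1) h" "h ` sphere 0 1 = X"
      "inj_on h (sphere 0 1)"
    using assms unfolding homeomorphic_def homeomorphism_def by (metis inj_on_def)
  define f where "f = (\<lambda>t. h (cis t))"
  have f: "continuous_on S f" for S
    unfolding f_def by (intro continuous_on_compose2[OF h(1)] continuous_intros) auto
  have inj: "inj_on f {a..<a + 2 * pi}" and im: "f ` {a..<a + 2 * pi} = X" for a
    using circle_arc_parametrisation[OF h(3), of a] h(2) by (auto simp: f_def)
  have fX: "f t \<in> X" for t using im[of t] by auto
  have per: "f (a + 2 * pi) = f a" for a by (simp add: f_def flip: cis_mult)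
  have X: "compact X" using compact_continuous_image[OF h(1)] h(2) by simp
  \<comment> \<open>The circle is cut open at an angle below \<open>2 * pi\<close>, and the interval found lies within one
    turn after the cut. So its left end lies below \<open>4 * pi\<close> and its right end below \<open>6 * pi\<close>.\<close>
  let ?D = "(\<lambda>(a, l). (a, a + l)) ` ({0..4 * pi} \<times> {0..2 * pi})"
  have "NC_star X = (\<lambda>(a, b). f ` {a..b}) ` ?D"
  proof (intro equalityI subsetI)
    fix A assume "A \<in> NC_star X"
    then have A: "A \<noteq> {}" "A \<subseteq> X" "closed A" "connected A"
      by (auto simp: NC_star_iff[OF X])
    have "\<exists>a l. a \<in> {0..4 * pi} \<and> l \<in> {0..2 * pi} \<and> A = f ` {a..a + l}"
    proof (cases "A = X")
      case True
      have "f ` {0..2 * pi} = X"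
        using im[of 0] fX by (force simp: image_subset_iff)
      then show ?thesis
        using True by (intro exI[of _ 0] exI[of _ "2 * pi"]) auto
    next
      case False
      then obtain s where s: "s \<in> {0..<2 * pi}" "f s \<notin> A"
        using im[of 0] A(2) by (metis add_0 image_iff psubsetI psubset_imp_ex_mem DiffD1 DiffD2)
      \<comment> \<open>Both ends of \<open>{s..s + 2 * pi}\<close> are mapped to the missed point, so \<open>B\<close> stays away from them
        and \<open>f\<close> is injective on \<open>B\<close>.\<close>
      define B where "B = {s..s + 2 * pi} \<inter> f -` A"
      have Bs: "B \<subseteq> {s<..<s + 2 * pi}"
        using s(2) per[of s] by (force simp: B_def less_le)
      have cB: "compact B"
        unfolding B_def using A(3) f by (intro compact_Int_closed closed_vimage) auto
      have fB: "f ` B = A"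
      proof
        show "A \<subseteq> f ` B"
        proof
          fix x assume "x \<in> A"
          moreover obtain t where "t \<in> {s..<s + 2 * pi}" "f t = x"
            using im[of s] A(2) \<open>x \<in> A\<close> by blast
          ultimately show "x \<in> f ` B" unfolding B_def by force
        qed
      qed (auto simp: B_def)
      obtain a b where ab: "a \<le> b" "B = {a..b}"
      proof (rule connected_image_interval[OF cB f])
        show "inj_on f B" using Bs by (intro inj_on_subset[OF inj[of s]]) auto
      qed (use fB A in auto)
      then have "s < a" "b < s + 2 * pi" using Bs by auto
      then show ?thesis
        using ab s fB by (intro exI[of _ a] exI[of _ "b - a"]) auto
    qed
    then obtain a l where "a \<in> {0..4 * pi}" "l \<in> {0..2 * pi}" "A = f ` {a..a + l}" by blast
    then show "A \<in> (\<lambda>(a, b). f ` {a..b}) ` ?D" by (force simp: image_iff)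
  next
    fix A assume "A \<in> (\<lambda>(a, b). f ` {a..b}) ` ?D"
    then obtain a l where al: "a \<in> {0..4 * pi}" "l \<in> {0..2 * pi}" "A = f ` {a..a + l}" by auto
    have "connected (X - A)"
    proof (cases "l = 2 * pi")
      case True
      then have "A = X" using al im[of a] fX by (force simp: image_subset_iff)
      then show ?thesis by simp
    next
      case False
      then have "{a..a + l} \<subseteq> {a..<a + 2 * pi}" using al by auto
      then have "X - A = f ` ({a..<a + 2 * pi} - {a..a + l})"
        unfolding al(3) using inj_on_image_set_diff[OF inj[of a], of "{a..<a + 2 * pi}" "{a..a + l}"]
        by (simp add: im)
      also have "{a..<a + 2 * pi} - {a..a + l} = {a + l<..<a + 2 * pi}"
        using al by auto
      finally show ?thesis using f by (simp add: connected_continuous_image)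
    qed
    then show "A \<in> NC_star X"
      using al fX compact_continuous_image[OF f] connected_continuous_image[OF f]
      by (auto simp: NC_star_iff[OF X] compact_imp_closed)
  qed
  also have "compactin (hyperspace X) \<dots>"
  proof (rule compactin_interval_images[OF X f, of 0 "6 * pi"])
    show "compact ?D"
      by (intro compact_continuous_image compact_Times)
        (auto intro!: continuous_intros simp: case_prod_unfold)
  qed (use fX in auto)
  finally show ?thesis .
qed

section \<open>Growing a subcontinuum into the centre of a star\<close>

text \<open>Boundary bumping, in the form needed for stars: here \<open>U\<close> is the open star and \<open>P\<close> the finite
  set of its tips.\<close>

lemma component_meets_boundary:
  fixes X :: "'a::metric_space set"
  assumes X: "compact X" "connected X"
    and U: "openin (top_of_set X) U" "U \<noteq> {}"
    and P: "closed (U \<union> P)" and C: "C \<in> components (X - U)"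
  shows "C \<inter> P \<noteq> {}"
proof -
  have UX: "U \<subseteq> X" using openin_imp_subset[OF U(1)] .
  have clS: "closedin (top_of_set X) (X - U)"
    using U(1) by (metis closedin_diff closedin_subtopology_refl subset_UNIV topspace_euclidean)
  have "C \<in> connected_components_of (subtopology (top_of_set X) (X - U))"
  proof -
    have eq: "subtopology (top_of_set X) (X - U) = top_of_set (X - U)"
      by (simp add: subtopology_subtopology Int_absorb1)
    have "connected_component_of_set (top_of_set (X - U)) x = connected_component_set (X - U) x" for x
      by (auto simp: connected_component_of_def connected_component_def connectedin_subtopology)
    then show ?thesis
      using C unfolding eq by (auto simp: connected_components_of_def components_def)
  qed
  then have "C \<inter> (top_of_set X) frontier_of (X - U) \<noteq> {}"
    by (intro boundary_bumping_theorem_closed clS)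
      (use X U UX connectedin_iff_connected[of X] in \<open>auto simp: connectedin_def compact_space_subtopology
        intro: Hausdorff_space_subtopology\<close>)
  moreover have "(top_of_set X) frontier_of (X - U) \<subseteq> P"
  proof -
    have "(top_of_set X) closure_of U \<subseteq> (U \<union> P) \<inter> X"
      using P UX by (intro closure_of_minimal) (auto simp: closedin_closed)
    moreover have "(top_of_set X) closure_of (X - U) \<subseteq> X - U"
      using clS by (intro closure_of_minimal) auto
    ultimately show ?thesis
      using UX unfolding frontier_of_closures by (auto simp: double_diff)
  qed
  ultimately show ?thesis by blast
qed

text \<open>A point \<open>v\<close> with a neighbourhood that is a finite union of arcs (the legs) issuing from \<open>v\<close> and
  otherwise disjoint. Openness is required for the legs without their tips \<open>leg i 1\<close>.\<close>

locale star_neighbourhood =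
  fixes X :: "'a::metric_space set" and v :: 'a and I :: "'i set" and leg :: "'i \<Rightarrow> real \<Rightarrow> 'a"
  assumes X: "compact X" "connected X"
    and finite_I: "finite I"
    and arc_leg: "i \<in> I \<Longrightarrow> arc (leg i)"
    and leg_0: "i \<in> I \<Longrightarrow> leg i 0 = v"
    and leg_sub: "i \<in> I \<Longrightarrow> leg i ` {0..1} \<subseteq> X"
    and leg_Int: "i \<in> I \<Longrightarrow> j \<in> I \<Longrightarrow> i \<noteq> j \<Longrightarrow> leg i ` {0..1} \<inter> leg j ` {0..1} \<subseteq> {v}"
    and openin_star: "openin (top_of_set X) (\<Union>i\<in>I. leg i ` {0..<1})"
begin

definition open_star where "open_star = (\<Union>i\<in>I. leg i ` {0..<1})"

lemma leg_eq_iff: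
  assumes "i \<in> I" "j \<in> I" "s \<in> {0..1}" "t \<in> {0..1}"
  shows "leg i s = leg j t \<longleftrightarrow> s = 0 \<and> t = 0 \<or> i = j \<and> s = t"
proof -
  have inj: "inj_on (leg k) {0..1}" if "k \<in> I" for k
    using arc_leg[OF that] by (simp add: arc_def)
  have 0: "leg k r = v \<longleftrightarrow> r = 0" if "k \<in> I" "r \<in> {0..1}" for k r
    using inj_onD[OF inj[OF that(1)], of r 0] leg_0[OF that(1)] that by auto
  show ?thesis
  proof (cases "i = j")
    case True
    then show ?thesis using inj_onD[OF inj[OF assms(1)]] assms by auto
  next
    case False
    have "s = 0 \<and> t = 0" if "leg i s = leg j t"
    proof -
      have "leg i s = v"
        using leg_Int[OF assms(1,2) False] assms(3,4) that by blast
      then show ?thesis using 0 assms that by metis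
    qed
    moreover have "leg i s = leg j t" if "s = 0 \<and> t = 0"
      using leg_0 assms(1,2) that by simp
    ultimately show ?thesis using False by blast
  qed
qed

lemma continuous_leg: "i \<in> I \<Longrightarrow> S \<subseteq> {0..1} \<Longrightarrow> continuous_on S (leg i)"
  using arc_leg by (auto simp: arc_def path_def intro: continuous_on_subset)

lemma connected_leg: "i \<in> I \<Longrightarrow> S \<subseteq> {0..1} \<Longrightarrow> connected S \<Longrightarrow> connected (leg i ` S)"
  by (intro connected_continuous_image continuous_leg)

lemma closed_leg: "i \<in> I \<Longrightarrow> S \<subseteq> {0..1} \<Longrightarrow> closed S \<Longrightarrow> closed (leg i ` S)"
  using compact_Int_closed[of "{0..1}" S]
  by (intro compact_imp_closed compact_continuous_image continuous_leg) (auto simp: inf.absorb2)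

lemma leg_in_open_star_iff:
  assumes "i \<in> I" "t \<in> {0..1}"
  shows "leg i t \<in> open_star \<longleftrightarrow> t < 1"
proof
  assume "leg i t \<in> open_star"
  then obtain j s where "j \<in> I" "s \<in> {0..<1}" "leg i t = leg j s" by (auto simp: open_star_def)
  then show "t < 1" using leg_eq_iff[of i j t s] assms by auto
next
  assume "t < 1"
  then show "leg i t \<in> open_star"
    unfolding open_star_def using assms by (intro UN_I[of i] imageI) auto
qed

lemma open_star_sub: "open_star \<subseteq> X"
  using leg_sub by (fastforce simp: open_star_def)

lemma closed_outside: "closed (X - open_star)"
proof -
  have "closedin (top_of_set X) (X - open_star)"
    using openin_star unfolding open_star_def
    by (metis closedin_diff closedin_subtopology_refl subset_UNIV topspace_euclidean)
  then show ?thesis using compact_imp_closed[OF X(1)] closedin_closed_eq by blast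
qed

lemma component_props:
  assumes "C \<in> components (X - open_star)"
  shows "closed C" "connected C" "C \<noteq> {}" "C \<subseteq> X - open_star"
  using assms closed_components[OF closed_outside] in_components_connected in_components_nonempty
    in_components_subset by blast+

lemma component_contains_tip:
  assumes I: "I \<noteq> {}" and C: "C \<in> components (X - open_star)"
  obtains i where "i \<in> I" "leg i 1 \<in> C"
proof -
  have "open_star \<union> (\<lambda>i. leg i 1) ` I = (\<Union>i\<in>I. leg i ` {0..1})"
    unfolding open_star_def by (force simp: less_le)
  moreover have "closed \<dots>"
    using finite_I by (intro closed_UN ballI closed_leg) auto
  moreover have "open_star \<noteq> {}" using I by (auto simp: open_star_def)
  ultimately have "C \<inter> (\<lambda>i. leg i 1) ` I \<noteq> {}"
    using component_meets_boundary[OF X _ _ _ C] openin_star by (simp add: open_star_def)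
  then show ?thesis using that by blast
qed

lemma tip_outside: "i \<in> I \<Longrightarrow> leg i 1 \<in> X - open_star"
  using leg_in_open_star_iff[of i 1] leg_sub[of i] by auto

definition tip_component where "tip_component i = connected_component_set (X - open_star) (leg i 1)"

lemma tip_component_in_components: "i \<in> I \<Longrightarrow> tip_component i \<in> components (X - open_star)"
  unfolding tip_component_def using tip_outside by (auto simp: components_def)

lemma tip_in_tip_component: "i \<in> I \<Longrightarrow> leg i 1 \<in> tip_component i"
  unfolding tip_component_def using tip_outside by simp

lemma tip_mem_component_iff:
  assumes "i \<in> I" "C \<in> components (X - open_star)"
  shows "leg i 1 \<in> C \<longleftrightarrow> tip_component i = C"
  using components_eq[OF assms(2) tip_component_in_components[OF assms(1)]]
    tip_in_tip_component[OF assms(1)]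
  by (metis IntI empty_iff)

text \<open>Finiteness makes every union of components closed, which is what the separation of the
  complement uses.\<close>

lemma finite_components:
  assumes "I \<noteq> {}" shows "finite (components (X - open_star))"
proof (rule finite_subset)
  show "components (X - open_star) \<subseteq> tip_component ` I"
    using component_contains_tip[OF assms] tip_mem_component_iff by blast
qed (simp add: finite_I)

text \<open>A component of the outside of the star, together with the part of the \<open>i\<close>-th leg that has been
  followed from its tip towards \<open>v\<close>. The centre \<open>v\<close> is reached at \<open>s = 0\<close>.\<close>

definition grown where "grown i s = tip_component i \<union> leg i ` {s..1}"

lemma grown_subcontinuum:
  assumes "i \<in> I" "s \<in> {0..1}"
  shows "grown i s \<in> subcontinua X"
proof -
  note c = component_props[OF tip_component_in_components[OF assms(1)]]
  have "connected (grown i s)"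
    unfolding grown_def using assms c tip_in_tip_component[OF assms(1)]
    by (intro connected_Un connected_leg) auto
  moreover have "leg i ` {s..1} \<subseteq> X"
    using leg_sub[OF assms(1)] assms(2) by force
  moreover have "closed (leg i ` {s..1})"
    using assms by (intro closed_leg) auto
  ultimately show ?thesis
    using c by (auto simp: subcontinua_iff[OF X(1)] grown_def)
qed

text \<open>As long as the growing leg has not reached \<open>v\<close>, the rest of the open star is connected through
  \<open>v\<close>. Every other component of the outside contains the tip of some other leg, and this leg ties it
  to \<open>v\<close>.\<close>

lemma connected_complement_grown:
  assumes i: "i \<in> I" and s: "0 < s" "s \<le> 1"
  shows "connected (X - grown i s)"
proof -
  \<comment> \<open>The part of each leg that remains in the open star: the \<open>i\<close>-th leg stops before \<open>s\<close>.\<close>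
  define J where "J = (\<lambda>j. if j = i then {0..<s} else {0..<1::real})"
  define S where "S = (\<Union>j\<in>I. leg j ` J j)"
  have J: "J j \<subseteq> {0..<1}" "connected (J j)" "0 \<in> J j" for j
    using s by (auto simp: J_def)
  have S_legs: "leg j ` J j \<subseteq> S" if "j \<in> I" for j
    using that by (auto simp: S_def)
  have vS: "v \<in> S" using S_legs[OF i] J(3)[of i] leg_0[OF i] by force
  have S: "connected S"
    unfolding S_def
  proof (rule connected_Union)
    fix C assume "C \<in> (\<lambda>j. leg j ` J j) ` I"
    then obtain j where "j \<in> I" and C: "C = leg j ` J j" by blast
    moreover have "J j \<subseteq> {0..1}" using J(1)[of j] by auto
    ultimately show "connected C" using connected_leg J(2) by blast
  next
    have "v \<in> leg j ` J j" if "j \<in> I" for j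
      using J(3)[of j] leg_0[OF that] by (metis imageI)
    then show "\<Inter> ((\<lambda>j. leg j ` J j) ` I) \<noteq> {}" by blast
  qed
  have rest: "open_star - leg i ` {s..1} = S"
  proof (intro equalityI subsetI)
    fix x assume x: "x \<in> open_star - leg i ` {s..1}"
    then obtain j t where "j \<in> I" "t \<in> {0..<1}" "x = leg j t" by (auto simp: open_star_def)
    with x have "t \<in> J j" by (auto simp: J_def not_le)
    then show "x \<in> S" using \<open>j \<in> I\<close> \<open>x = leg j t\<close> by (auto simp: S_def)
  next
    fix x assume "x \<in> S"
    then obtain j t where jt: "j \<in> I" "t \<in> J j" "x = leg j t" by (auto simp: S_def)
    then have "t \<in> {0..<1}" using J(1)[of j] by blast
    then have "x \<in> open_star" unfolding open_star_def jt(3) using jt(1) by (intro UN_I[of j] imageI) auto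
    moreover have "x \<noteq> leg i r" if "r \<in> {s..1}" for r
      using jt leg_eq_iff[of j i t r] i s that \<open>t \<in> {0..<1}\<close> by (auto simp: J_def split: if_splits)
    ultimately show "x \<in> open_star - leg i ` {s..1}" by blast
  qed
  define \<C> where "\<C> = components (X - open_star) - {tip_component i}"
  have conC: "connected (S \<union> C)" if "C \<in> \<C>" for C
  proof -
    have C: "C \<in> components (X - open_star)" "C \<noteq> tip_component i" using that by (auto simp: \<C>_def)
    obtain j where j: "j \<in> I" "leg j 1 \<in> C"
      using component_contains_tip[OF _ C(1)] i by blast
    then have "j \<noteq> i" using tip_mem_component_iff C by blast
    have "connected (leg j ` {0..1})" by (intro connected_leg j) auto
    moreover have "S \<union> leg j ` {0..1} \<union> C = S \<union> C"
    proof -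
      have "leg j t \<in> S \<union> C" if "t \<in> {0..1}" for t
        using that S_legs[OF j(1)] j(2) \<open>j \<noteq> i\<close> by (cases "t = 1") (auto simp: J_def)
      then show ?thesis by blast
    qed
    moreover have "v \<in> S \<inter> leg j ` {0..1}"
      using vS leg_0[OF j(1)] by (force simp: image_iff)
    ultimately show ?thesis
      using S component_props(2)[OF C(1)] j(2)
      by (metis (no_types, lifting) connected_Un IntI Un_iff atLeastAtMost_iff
          empty_iff imageI le_numeral_extra(4) zero_le_one)
  qed
  have "X - grown i s = \<Union> (insert S ((\<lambda>C. S \<union> C) ` \<C>))"
  proof -
    have "X - grown i s = (open_star - leg i ` {s..1}) \<union> (X - open_star - tip_component i)"
      using open_star_sub component_props(4)[OF tip_component_in_components[OF i]] i s
        leg_in_open_star_iff[OF i] tip_in_tip_component[OF i] unfolding grown_def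
      by (auto simp: less_le)
    moreover have "X - open_star - tip_component i = \<Union>\<C>"
    proof -
      have "X - open_star = \<Union> (components (X - open_star))" by simp
      moreover have "C \<inter> tip_component i = {}" if "C \<in> \<C>" for C
        using that components_nonoverlap tip_component_in_components[OF i] by (auto simp: \<C>_def)
      ultimately show ?thesis unfolding \<C>_def by blast
    qed
    ultimately show ?thesis using rest by auto
  qed
  moreover have "connected (\<Union> (insert S ((\<lambda>C. S \<union> C) ` \<C>)))"
    using S conC vS by (intro connected_Union) auto
  ultimately show ?thesis by simp
qed

text \<open>Once \<open>v\<close> itself is swallowed, the \<open>j\<close>-th leg can be linked to the rest of the complement only
  through the component at its own tip. If that component is the removed one, nothing remains but the
  open leg. If distinct legs have distinct components, the component hangs on the \<open>j\<close>-th leg alone. In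
  both cases the leg with its component is cut off from the \<open>k\<close>-th leg.\<close>

lemma disconnected_complement_grown_0:
  assumes I: "i \<in> I" "j \<in> I" "k \<in> I" "i \<noteq> j" "i \<noteq> k" "j \<noteq> k"
    and comp: "tip_component j = tip_component i \<or> inj_on tip_component I"
  shows "\<not> connected (X - grown i 0)"
proof -
  define A where "A = tip_component j \<union> leg j ` {0..1}"
  define B where "B = \<Union> (components (X - open_star) - {tip_component j}) \<union> (\<Union>l\<in>I - {j}. leg l ` {0..1})"
  note cj = component_props[OF tip_component_in_components[OF I(2)]]
  note ci = component_props[OF tip_component_in_components[OF I(1)]]
  have "closed A"
    unfolding A_def using cj I by (intro closed_Un closed_leg) auto
  have "closed B"
    unfolding B_def using finite_components component_props finite_I I
    by (intro closed_Un closed_Union closed_UN ballI closed_leg) auto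
  have cover: "X \<subseteq> A \<union> B"
  proof
    fix x assume "x \<in> X"
    show "x \<in> A \<union> B"
    proof (cases "x \<in> open_star")
      case True
      then obtain l t where "l \<in> I" "t \<in> {0..<1}" "x = leg l t" by (auto simp: open_star_def)
      then have "l \<in> I" "x \<in> leg l ` {0..1}" by (auto intro!: imageI)
      then show ?thesis unfolding A_def B_def by blast
    next
      case False
      then have "x \<in> \<Union> (components (X - open_star))" using \<open>x \<in> X\<close> by simp
      then show ?thesis unfolding A_def B_def by blast
    qed
  qed
  have overlap: "A \<inter> B \<subseteq> grown i 0"
  proof
    fix x assume x: "x \<in> A \<inter> B"
    have v: "v \<in> grown i 0" unfolding grown_def using leg_0[OF I(1)] by force
    have other: "x \<notin> C" if "x \<in> tip_component j" "C \<in> components (X - open_star) - {tip_component j}" for C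
      using that components_nonoverlap[OF tip_component_in_components[OF I(2)], of C] by blast
    show "x \<in> grown i 0"
    proof (cases "x \<in> tip_component j")
      case True
      then obtain l t where l: "l \<in> I" "l \<noteq> j" "t \<in> {0..1}" "x = leg l t"
        using x other unfolding B_def by blast
      then have "t = 1"
        using leg_in_open_star_iff[of l t] True cj(4) by force
      then have "tip_component l = tip_component j"
        using l True tip_mem_component_iff[OF l(1) tip_component_in_components[OF I(2)]] by simp
      then have "tip_component j = tip_component i" using comp l I by (auto simp: inj_on_def)
      then show ?thesis using True by (simp add: grown_def)
    next
      case False
      then obtain t where t: "t \<in> {0..1}" "x = leg j t" using x by (auto simp: A_def)
      then have "t < 1" using False tip_in_tip_component[OF I(2)] by (cases "t = 1") auto
      then have "x \<in> open_star" using t leg_in_open_star_iff I by blast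
      then obtain l s where l: "l \<in> I" "l \<noteq> j" "s \<in> {0..1}" "x = leg l s"
        using x component_props(4) unfolding B_def by blast
      then have "t = 0" using leg_eq_iff[of j l t s] t I by auto
      then show ?thesis using v t leg_0 I by simp
    qed
  qed
  have half: "leg l (1/2) \<in> X - grown i 0" if "l \<in> I" "l \<noteq> i" for l
  proof -
    have "leg l (1/2) \<in> open_star" using leg_in_open_star_iff[OF that(1)] by simp
    then have "leg l (1/2) \<in> X - tip_component i" using open_star_sub ci(4) by blast
    moreover have "leg l (1/2) \<noteq> leg i s" if "s \<in> {0..1}" for s
      using leg_eq_iff[of l i "1/2" s] that I \<open>l \<in> I\<close> \<open>l \<noteq> i\<close> by simp
    ultimately show ?thesis unfolding grown_def by blast
  qed
  have mid: "leg l (1/2) \<in> leg l ` {0..1}" for l by (intro imageI) auto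
  have "leg j (1/2) \<in> A" unfolding A_def by (rule UnI2[OF mid])
  moreover have "leg k (1/2) \<in> B"
    unfolding B_def using I(3,6) by (intro UnI2 UN_I[of k] mid) simp
  ultimately have "A \<inter> (X - grown i 0) \<noteq> {}" "B \<inter> (X - grown i 0) \<noteq> {}"
    using half[OF I(2)] half[OF I(3)] I(4,5) by (metis IntI empty_iff)+
  moreover have "X - grown i 0 \<subseteq> A \<union> B" "A \<inter> B \<inter> (X - grown i 0) = {}"
    using cover overlap by blast+
  ultimately show ?thesis
    unfolding connected_closed using \<open>closed A\<close> \<open>closed B\<close> by blast
qed

text \<open>Three legs suffice for a choice of \<open>i\<close>, \<open>j\<close> as in the previous lemma: if two legs lead to the
  same component take these, and otherwise any two. The resulting \<open>grown i 0\<close> is a limit of members of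
  \<open>NC_star X\<close> that does not belong to \<open>NC_star X\<close>.\<close>

lemma not_compactin_NC_star:
  assumes I: "i \<in> I" "j \<in> I" "k \<in> I" "i \<noteq> j" "i \<noteq> k" "j \<noteq> k"
  shows "\<not> compactin (hyperspace X) (NC_star X)"
proof
  assume cpt: "compactin (hyperspace X) (NC_star X)"
  have "\<exists>i j k. i \<in> I \<and> j \<in> I \<and> k \<in> I \<and> i \<noteq> j \<and> i \<noteq> k \<and> j \<noteq> k \<and>
      (tip_component j = tip_component i \<or> inj_on tip_component I)"
  proof (cases "inj_on tip_component I")
    case True
    then show ?thesis using I by blast
  next
    case False
    then obtain i' j' where ij: "i' \<in> I" "j' \<in> I" "i' \<noteq> j'" "tip_component j' = tip_component i'"
      unfolding inj_on_def by metis
    then obtain k' where "k' \<in> I" "k' \<noteq> i'" "k' \<noteq> j'" using I by metis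
    then show ?thesis using ij by metis
  qed
  then obtain i j k where I: "i \<in> I" "j \<in> I" "k \<in> I" "i \<noteq> j" "i \<noteq> k" "j \<noteq> k"
    and comp: "tip_component j = tip_component i \<or> inj_on tip_component I" by blast
  have "grown i 0 \<in> NC_star X"
  proof (rule NC_star_limit[OF X(1) cpt])
    show L: "grown i 0 \<in> subcontinua X" using grown_subcontinuum[OF I(1)] by simp
    fix e :: real assume "e > 0"
    have "continuous_on {0..1} (leg i)" by (rule continuous_leg[OF I(1) order_refl])
    then obtain d where d: "d > 0" "\<And>t. t \<in> {0..1} \<Longrightarrow> dist t 0 < d \<Longrightarrow> dist (leg i t) (leg i 0) < e / 4"
      using \<open>e > 0\<close> unfolding continuous_on_iff
      by (metis atLeastAtMost_iff order_refl zero_le_one zero_less_divide_iff zero_less_numeral)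
    define s where "s = min 1 (d / 2)"
    have s: "0 < s" "s \<le> 1" "s < d" using d(1) by (auto simp: s_def)
    have gs: "grown i s \<in> subcontinua X" using grown_subcontinuum[OF I(1)] s by simp
    have sub: "grown i s \<subseteq> grown i 0" using s by (auto simp: grown_def)
    have near: "\<exists>y\<in>grown i s. dist x y \<le> e / 2" if x: "x \<in> grown i 0" for x
    proof (cases "x \<in> grown i s")
      case True
      then show ?thesis using \<open>e > 0\<close> by (intro bexI[of _ x]) auto
    next
      case False
      then obtain t where t: "0 \<le> t" "t < s" "x = leg i t" using x by (fastforce simp: grown_def)
      have "dist (leg i t) (leg i s) \<le> dist (leg i t) (leg i 0) + dist (leg i s) (leg i 0)"
        by (rule dist_triangle2)
      also have "\<dots> \<le> e / 4 + e / 4"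
        using t s by (intro add_mono less_imp_le d(2)) auto
      finally show ?thesis
        using t s by (intro bexI[of _ "leg i s"]) (auto simp: grown_def)
    qed
    have "hausdorff_dist (grown i 0) (grown i s) \<le> e / 2"
      using subcontinua_bounded[OF X(1) L] subcontinua_bounded[OF X(1) gs] near sub \<open>e > 0\<close>
      by (intro hausdorff_dist_leI) (auto intro!: bexI)
    moreover have "grown i s \<in> NC_star X"
      using gs connected_complement_grown[OF I(1) s(1,2)] by (simp add: NC_star_def)
    ultimately show "\<exists>A\<in>NC_star X. hausdorff_dist (grown i 0) A < e"
      using \<open>e > 0\<close> by (intro bexI[of _ "grown i s"]) auto
  qed
  then show False
    using disconnected_complement_grown_0[OF I comp] by (simp add: NC_star_def)
qed

end

section \<open>Finite graphs\<close>

definition ends :: "(real \<Rightarrow> 'a::topological_space) \<Rightarrow> 'a set" where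
  "ends g = {pathstart g, pathfinish g}"

definition arc_family :: "(real \<Rightarrow> 'a::metric_space) set \<Rightarrow> bool" where
  "arc_family G \<longleftrightarrow> finite G \<and> (\<forall>g\<in>G. arc g) \<and>
     pairwise (\<lambda>g h. path_image g \<inter> path_image h \<subseteq> ends g \<inter> ends h) G"

text \<open>Only the image and the end points of an arc matter, so any end point may be taken as the
  start.\<close>

lemma orient_towards:
  assumes "arc g" "x \<in> ends g"
  obtains k where "arc k" "path_image k = path_image g" "ends k = ends g" "pathstart k = x"
proof (cases "pathstart g = x")
  case True
  then show ?thesis using that assms by blast
next
  case False
  show ?thesis
  proof (rule that)
    show "arc (reversepath g)" using assms(1) by (rule arc_reversepath)
    show "pathstart (reversepath g) = x" using assms(2) False by (simp add: ends_def)
  qed (simp_all add: ends_def insert_commute)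
qed

lemma family_Int:
  "arc_family G \<Longrightarrow> g \<in> G \<Longrightarrow> h \<in> G \<Longrightarrow> g \<noteq> h \<Longrightarrow>
    path_image g \<inter> path_image h \<subseteq> ends g \<inter> ends h"
  by (auto simp: arc_family_def pairwise_def)

lemma closed_Union_arcs:
  assumes "arc_family G" "H \<subseteq> G" shows "closed (\<Union>g\<in>H. path_image g)"
  using assms finite_subset[of H G]
  by (intro closed_UN) (auto simp: arc_family_def intro!: closed_path_image arc_imp_path)

text \<open>Induction on the number of arcs. If there are at least two, connectedness yields two that
  share an end point, and this point lies on no third arc. Either the two arcs share both end points;
  then they form a loop that no further arc can touch, so the loop is everything. Or they are
  concatenated into a single arc, which leaves a smaller family of the same kind.\<close>

lemma arc_or_circle_if_no_branching:
  assumes "arc_family G" "G \<noteq> {}" "connected (\<Union>g\<in>G. path_image g)"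
    and "\<And>x f g h. f \<in> G \<Longrightarrow> g \<in> G \<Longrightarrow> h \<in> G \<Longrightarrow> x \<in> ends f \<inter> ends g \<inter> ends h \<Longrightarrow>
      f = g \<or> g = h \<or> f = h"
  shows "\<exists>c. path_image c = (\<Union>g\<in>G. path_image g) \<and>
    (arc c \<or> simple_path c \<and> pathfinish c = pathstart c)"
  using assms
proof (induction "card G" arbitrary: G rule: less_induct)
  case less
  note G = less.prems(1) and conn = less.prems(3) and deg = less.prems(4)
  have fin: "finite G" and arcs: "\<And>g. g \<in> G \<Longrightarrow> arc g"
    using G by (auto simp: arc_family_def)
  \<comment> \<open>No proper nonempty subfamily is disjoint from the remaining arcs.\<close>
  have all: "H = G" if H: "H \<subseteq> G" "H \<noteq> {}"
    and dis: "\<And>g h. g \<in> H \<Longrightarrow> h \<in> G - H \<Longrightarrow> path_image g \<inter> path_image h = {}" for H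
  proof (rule ccontr)
    assume "H \<noteq> G"
    let ?A = "\<Union>g\<in>H. path_image g" and ?B = "\<Union>g\<in>G - H. path_image g"
    have "closed ?A" "closed ?B" by (rule closed_Union_arcs[OF G]; use H in blast)+
    moreover have "?A \<inter> (\<Union>g\<in>G. path_image g) \<noteq> {}" "?B \<inter> (\<Union>g\<in>G. path_image g) \<noteq> {}"
      using H \<open>H \<noteq> G\<close> path_image_nonempty by blast+
    moreover have "?A \<inter> ?B \<inter> (\<Union>g\<in>G. path_image g) = {}" using dis by blast
    moreover have "(\<Union>g\<in>G. path_image g) \<subseteq> ?A \<union> ?B" by blast
    ultimately show False
      using connected_closedD[OF conn] by metis
  qed
  obtain g where g: "g \<in> G" using less.prems(2) by blast
  show ?case
  proof (cases "G = {g}")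
    case True
    then show ?thesis using arcs g by auto
  next
    case False
    then obtain h where h: "h \<in> G" "h \<noteq> g" "path_image g \<inter> path_image h \<noteq> {}"
      using all[of "{g}"] g by blast
    then obtain x where x: "x \<in> path_image g \<inter> path_image h" by blast
    then have xe: "x \<in> ends g" "x \<in> ends h"
      using family_Int[OF G g h(1)] h(2) by auto
    obtain g0 where g0: "arc g0" "path_image g0 = path_image g" "ends g0 = ends g" "pathstart g0 = x"
      using orient_towards[OF arcs[OF g] xe(1)] .
    define g' where "g' = reversepath g0"
    have g': "arc g'" "path_image g' = path_image g" "ends g = {pathstart g', x}" "pathfinish g' = x"
      using g0 by (auto simp: g'_def ends_def arc_reversepath)
    obtain h' where h': "arc h'" "path_image h' = path_image h" "ends h' = ends h" "pathstart h' = x"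
      using orient_towards[OF arcs[OF h(1)] xe(2)] .
    have eh: "ends h = {x, pathfinish h'}" using h' by (auto simp: ends_def)
    have gh: "path_image g' \<inter> path_image h' \<subseteq> ends g \<inter> ends h"
      using family_Int[OF G g h(1)] h(2) g' h' by auto
    have other: "f \<in> G - {g, h} \<Longrightarrow> x \<notin> ends f" for f
      using deg[of f g h x] xe g h by blast
    have meet: "path_image f \<inter> path_image g \<subseteq> ends f \<inter> (ends g - {x})"
      "path_image f \<inter> path_image h \<subseteq> ends f \<inter> (ends h - {x})" if "f \<in> G - {g, h}" for f
      using family_Int[OF G, of f g] family_Int[OF G, of f h] that g h other[OF that] by blast+
    have join: "path_image (g' +++ h') = path_image g \<union> path_image h"
      using path_image_join[of g' h'] g' h' by simp
    show ?thesis
    proof (cases "pathstart g' = pathfinish h'")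
      case True
      have "simple_path (g' +++ h')"
        using g' h' gh True eh by (intro simple_path_join_loop) auto
      moreover have "{g, h} = G"
      proof (rule all)
        fix k f assume k: "k \<in> {g, h}" and f: "f \<in> G - {g, h}"
        have "y \<notin> ends f" if "y \<in> ends g" "y \<in> ends h" for y
          using deg[of f g h y] that f g h by blast
        moreover have "ends g = ends h" using True eh g'(3) by auto
        ultimately show "path_image k \<inter> path_image f = {}"
          using meet[OF f] k by blast
      qed (use g h in auto)
      ultimately show ?thesis
        using join True by (intro exI[of _ "g' +++ h'"]) auto
    next
      case False
      define k where "k = g' +++ h'"
      have ak: "arc k"
        unfolding k_def using g' h' gh False eh by (intro arc_join) auto
      have ek: "ends k = {pathstart g', pathfinish h'}" by (simp add: k_def ends_def)
      have ik: "path_image k = path_image g \<union> path_image h" using join by (simp add: k_def)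
      have xg: "pathstart g' \<noteq> x" using arc_distinct_ends[OF g'(1)] g'(4) by simp
      have xh: "pathfinish h' \<noteq> x" using arc_distinct_ends[OF h'(1)] h'(4) by simp
      have ek': "ends k = (ends g - {x}) \<union> (ends h - {x})" using ek g'(3) eh xg xh by auto
      define G' where "G' = insert k (G - {g, h})"
      have meet_k: "path_image f \<inter> path_image k \<subseteq> ends f \<inter> ends k" if "f \<in> G - {g, h}" for f
        using meet[OF that] unfolding ik ek' by blast
      have "arc_family G'"
        unfolding arc_family_def
      proof (intro conjI pairwiseI)
        fix a b assume ab: "a \<in> G'" "b \<in> G'" "a \<noteq> b"
        then consider "a \<in> G - {g, h}" "b \<in> G - {g, h}" | "a = k" "b \<in> G - {g, h}" | "a \<in> G - {g, h}" "b = k"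
          unfolding G'_def by blast
        then show "path_image a \<inter> path_image b \<subseteq> ends a \<inter> ends b"
        proof cases
          case 1 then show ?thesis using family_Int[OF G] ab by blast
        next
          case 2 then show ?thesis using meet_k[of b] by blast
        next
          case 3 then show ?thesis using meet_k[of a] by blast
        qed
      qed (use fin ak arcs in \<open>auto simp: G'_def\<close>)
      moreover have un: "(\<Union>f\<in>G'. path_image f) = (\<Union>f\<in>G. path_image f)"
        using ik g h by (auto simp: G'_def)
      moreover have "card G' < card G"
      proof -
        have "card G' \<le> Suc (card (G - {g, h}))" using fin by (simp add: G'_def card_insert_if)
        also have "\<dots> < Suc (Suc (card (G - {g, h})))" by simp
        also have "\<dots> = card (insert g (insert h (G - {g, h})))" using fin h by simp
        also have "insert g (insert h (G - {g, h})) = G" using g h by auto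
        finally show ?thesis .
      qed
      moreover have "f1 = f2 \<or> f2 = f3 \<or> f1 = f3"
        if f: "f1 \<in> G'" "f2 \<in> G'" "f3 \<in> G'" and y: "y \<in> ends f1 \<inter> ends f2 \<inter> ends f3" for y f1 f2 f3
      proof -
        \<comment> \<open>In a triple of arcs with common end point \<open>y\<close>, the new arc \<open>k\<close> can be replaced by the one of
          \<open>g\<close>, \<open>h\<close> that contributes \<open>y\<close>. This reduces the claim to the old family.\<close>
        obtain m where m: "m \<in> {g, h}" "y \<in> ends k \<longrightarrow> y \<in> ends m" using ek' by blast
        define r where "r = (\<lambda>f. if f = k then m else f)"
        have r: "r f \<in> G" "y \<in> ends f \<Longrightarrow> y \<in> ends (r f)" if "f \<in> G'" for f
          using that m g h by (auto simp: r_def G'_def)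
        have inj: "r a = r b \<Longrightarrow> a = b" if "a \<in> G'" "b \<in> G'" for a b
          using that m by (auto simp: r_def G'_def split: if_splits)
        have "r f1 = r f2 \<or> r f2 = r f3 \<or> r f1 = r f3"
          using deg[of "r f1" "r f2" "r f3" y] r f y by blast
        then show ?thesis using inj f by blast
      qed
      ultimately show ?thesis
        using less.hyps[of G'] conn by (auto simp: G'_def)
    qed
  qed
qed

text \<open>A common end point \<open>v\<close> of three arcs is the centre of a star: its legs are the halves next to
  \<open>v\<close> of all arcs ending at \<open>v\<close>. Halving keeps two legs from meeting again at their far ends.\<close>

lemma branching_not_compactin_NC_star:
  fixes X :: "'a::metric_space set"
  assumes X: "compact X" "connected X" "X = (\<Union>g\<in>G. path_image g)"
    and G: "arc_family G"
    and fgh: "f \<in> G" "g \<in> G" "h \<in> G" "f \<noteq> g" "g \<noteq> h" "f \<noteq> h"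
    and v: "v \<in> ends f" "v \<in> ends g" "v \<in> ends h"
  shows "\<not> compactin (hyperspace X) (NC_star X)"
proof -
  define I where "I = {g \<in> G. v \<in> ends g}"
  have "\<forall>g\<in>I. \<exists>k. arc k \<and> path_image k = path_image g \<and> ends k = ends g \<and> pathstart k = v"
    using orient_towards G unfolding I_def arc_family_def by (metis (no_types, lifting) mem_Collect_eq)
  then obtain q where q: "\<And>g. g \<in> I \<Longrightarrow> arc (q g) \<and> path_image (q g) = path_image g \<and>
      ends (q g) = ends g \<and> pathstart (q g) = v"
    by metis
  define leg where "leg = (\<lambda>g t. q g (t / 2))"
  have leg_im: "leg g ` S = q g ` ((\<lambda>t. t / 2) ` S)" for g S
    by (simp add: leg_def image_image)
  have half: "(\<lambda>t. t / 2) ` {0..1} = {0..1/2::real}" "(\<lambda>t. t / 2) ` {0..<1} = {0..<1/2::real}"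
    by (auto simp: image_iff intro!: bexI[of _ "2 * _"])
  have inj: "inj_on (q g) {0..1}" and cont: "continuous_on {0..1} (q g)" if "g \<in> I" for g
    using q[OF that] by (auto simp: arc_def path_def)
  have o0: "q g 0 = v" if "g \<in> I" for g
    using q[OF that] by (simp add: pathstart_def)
  have near_end: "q g t = v" if "g \<in> I" "t \<in> {0..1/2}" "q g t \<in> ends g" for g t
  proof -
    have "q g t \<in> {q g 0, q g 1}"
      using q[OF that(1)] that(3) by (metis ends_def pathstart_def pathfinish_def)
    then have "t = 0"
      using inj_onD[OF inj[OF that(1)], of t 0] inj_onD[OF inj[OF that(1)], of t 1] that(2) by auto
    then show ?thesis using o0 that by simp
  qed
  have oim: "q g t \<in> path_image g" if "g \<in> I" "t \<in> {0..1}" for g t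
    using q[OF that(1)] that(2) unfolding path_image_def by blast
  have foreign: "q g t = v" if "g \<in> I" "k \<in> G" "k \<noteq> g" "t \<in> {0..1/2}" "q g t \<in> path_image k" for g k t
    using family_Int[OF G, of g k] oim[OF that(1), of t] near_end that unfolding I_def by fastforce
  let ?U = "\<Union>g\<in>I. leg g ` {0..<1}"
  \<comment> \<open>The closed rest of the graph: all arcs that avoid \<open>v\<close>, and the far halves of the others.\<close>
  let ?R = "(\<Union>g\<in>G - I. path_image g) \<union> (\<Union>g\<in>I. q g ` {1/2..1})"
  have "star_neighbourhood X v I leg"
  proof
    show "compact X" "connected X" by fact+
    show "finite I" using G by (simp add: I_def arc_family_def)
    fix g assume g: "g \<in> I"
    have "continuous_on {0..1} (leg g)"
      unfolding leg_def by (rule continuous_on_compose2[OF cont[OF g]]) (auto intro!: continuous_intros)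
    moreover have "inj_on (leg g) {0..1}"
    proof (rule inj_onI)
      fix s t :: real assume "s \<in> {0..1}" "t \<in> {0..1}" "leg g s = leg g t"
      then show "s = t"
        using inj_onD[OF inj[OF g], of "s / 2" "t / 2"] by (simp add: leg_def)
    qed
    ultimately show "arc (leg g)" by (simp add: arc_def path_def)
    show "leg g 0 = v" using o0[OF g] by (simp add: leg_def)
    show "leg g ` {0..1} \<subseteq> X"
      using oim[OF g] g unfolding leg_im half X(3) I_def by force
    fix k assume k: "k \<in> I" "g \<noteq> k"
    show "leg g ` {0..1} \<inter> leg k ` {0..1} \<subseteq> {v}"
    proof
      fix y assume "y \<in> leg g ` {0..1} \<inter> leg k ` {0..1}"
      then obtain s t where "s \<in> {0..1/2}" "t \<in> {0..1/2}" "y = q g s" "y = q k t"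
        unfolding leg_im half by blast
      then show "y \<in> {v}"
        using foreign[OF g, of k s] oim[OF k(1), of t] k by (auto simp: I_def)
    qed
  next
    have "closed ?R"
    proof (intro closed_Un closed_Union_arcs[OF G] closed_UN ballI)
      show "finite I" using G by (simp add: I_def arc_family_def)
      show "closed (q g ` {1/2..1})" if "g \<in> I" for g
        using cont[OF that]
        by (intro compact_imp_closed compact_continuous_image) (auto elim: continuous_on_subset)
    qed auto
    moreover have "X - ?U = X \<inter> ?R"
    proof (intro equalityI subsetI)
      fix y assume y: "y \<in> X - ?U"
      then obtain g where g: "g \<in> G" "y \<in> path_image g" using X(3) by blast
      show "y \<in> X \<inter> ?R"
      proof (cases "g \<in> I")
        case True
        then obtain t where t: "t \<in> {0..1}" "y = q g t"
          using q[OF True] g unfolding path_image_def by blast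
        then have "\<not> t < 1/2" using y True unfolding leg_im half by auto
        then have "y \<in> q g ` {1/2..1}" using t by auto
        then show ?thesis using y True by blast
      qed (use y g in blast)
    next
      fix y assume y: "y \<in> X \<inter> ?R"
      have "y \<notin> leg g ` {0..<1}" if g: "g \<in> I" for g
      proof
        assume "y \<in> leg g ` {0..<1}"
        then obtain t where t: "t \<in> {0..<1/2}" "y = q g t" unfolding leg_im half by blast
        from y consider k where "k \<in> G - I" "y \<in> path_image k"
          | k s where "k \<in> I" "s \<in> {1/2..1}" "y = q k s" by blast
        then show False
        proof cases
          case 1
          then have "y \<in> ends k"
            using family_Int[OF G, of g k] oim[OF g, of t] t g unfolding I_def by fastforce
          moreover have "y = v" using foreign[OF g, of k t] 1 t g by auto
          ultimately show False using 1 by (simp add: I_def)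
        next
          case 2
          show False
          proof (cases "k = g")
            case True
            then show False using inj_onD[OF inj[OF g], of t s] t 2 by auto
          next
            case False
            then have "y = v" using foreign[OF g, of k t] oim[OF 2(1), of s] t 2 by (auto simp: I_def)
            then show False
              using inj_onD[OF inj[OF 2(1)], of s 0] o0[OF 2(1)] 2 by auto
          qed
        qed
      qed
      then show "y \<in> X - ?U" using y by blast
    qed
    ultimately have "closedin (top_of_set X) (X - ?U)"
      by (metis closedin_closed_Int)
    moreover have "?U \<subseteq> X"
      using oim X(3) unfolding leg_im half I_def by fastforce
    ultimately show "openin (top_of_set X) ?U"
      by (simp add: openin_closedin)
  qed
  then interpret star_neighbourhood X v I leg .
  show ?thesis
    using not_compactin_NC_star[of f g h] fgh v by (simp add: I_def)
qed

theorem theorem3p9: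
  fixes X :: "'a::metric_space set"
  assumes "finite_graph X"
  shows "compact_space (subtopology (hyperspace X) (NC_star X)) \<longleftrightarrow>
    X homeomorphic {0..1::real} \<or> X homeomorphic sphere (0::complex) 1"
proof -
  obtain G where "finite G" "\<forall>g\<in>G. arc g" and XG: "X = (\<Union>g\<in>G. path_image g)"
    and "pairwise (\<lambda>g h. path_image g \<inter> path_image h \<subseteq>
          {pathstart g, pathfinish g} \<inter> {pathstart h, pathfinish h}) G"
    using assms unfolding finite_graph_def by blast
  then have G: "arc_family G" by (simp add: arc_family_def ends_def)
  have X: "compact X" "connected X" "X \<noteq> {}"
    using assms by (auto simp: finite_graph_def continuum_def)
  have "NC_star X \<subseteq> topspace (hyperspace X)"
    using Metric_space.topspace_mtopology[OF Metric_space_subcontinua[OF X(1)]]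
    by (auto simp: hyperspace_def NC_star_def)
  then have iff: "compact_space (subtopology (hyperspace X) (NC_star X)) \<longleftrightarrow>
      compactin (hyperspace X) (NC_star X)"
    by (simp add: compactin_subspace)
  show ?thesis
    unfolding iff
  proof
    assume cpt: "compactin (hyperspace X) (NC_star X)"
    have "\<exists>c. path_image c = (\<Union>g\<in>G. path_image g) \<and>
        (arc c \<or> simple_path c \<and> pathfinish c = pathstart c)"
    proof (rule arc_or_circle_if_no_branching[OF G])
      show "f = g \<or> g = h \<or> f = h"
        if "f \<in> G" "g \<in> G" "h \<in> G" "x \<in> ends f \<inter> ends g \<inter> ends h" for x f g h
        using branching_not_compactin_NC_star[OF X(1,2) XG G] that cpt by blast
    qed (use X XG in auto)
    then obtain c where c: "path_image c = X" "arc c \<or> simple_path c \<and> pathfinish c = pathstart c"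
      using XG by blast
    then show "X homeomorphic {0..1::real} \<or> X homeomorphic sphere (0::complex) 1"
      using homeomorphic_unit_interval_iff_arc[of X] homeomorphic_simple_path_image_circle[of c 1 0]
      by auto
  next
    assume "X homeomorphic {0..1::real} \<or> X homeomorphic sphere (0::complex) 1"
    then show "compactin (hyperspace X) (NC_star X)"
      using compactin_NC_star_arc compactin_NC_star_circle by blast
  qed
qed

end
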